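(* Let $p>0$, let $x_0\in\mathbb{R}$, and let $f:\mathbb{R}\to\mathbb{R}$ be a $p$-periodic function with $n$-th periodic generation $f_n$ (of period $p/2^n$) and $n$-th antiperiodic generation $\tilde f_n$. If $$\lim_{n\to\infty}\ \sup_{x_0\le x\le x_0+p}|f_n(x)|=0,$$ then $f$ is represented by the infinite series of its antiperiodic generations, $$f(x)=\sum_{n=1}^{\infty}\tilde f_n(x)\quad\text{for all }x\in[x_0,x_0+p],$$ and the convergence is uniform on $[x_0,x_0+p]$.
   Context: For $q>0$, a function $f:\mathbb{R}\to\mathbb{R}$ is $q$-periodic if $f(x+q)=f(x)$ for all $x$, and $q$-antiperiodic if $f(x+q)=-f(x)$ for all $x$. Every $q$-periodic function can be written uniquely as the sum of a $q/2$-periodic function and a $q/2$-antiperiodic function. For a $p$-periodic function $f$, the periodic generations $f_n$ and antiperiodic generations $\tilde f_n$ are defined recursively: $f_0=f$, and for $n\ge1$, $f_{n-1}=f_n+\tilde f_n$ is the unique decomposition of the $p/2^{n-1}$-periodic function $f_{n-1}$ into a $p/2^n$-periodic function $f_n$ (the $n$-th periodic generation of $f$) and a $p/2^n$-antiperiodic function $\tilde f_n$ (the $n$-th antiperiodic generation of $f$). *)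

theory Defs
  imports "HOL-Analysis.Analysis" "HOL-Library.Periodic_Fun" "HOL-Library.Extended_Real"
begin

definition antiperiodic :: "real \<Rightarrow> (real \<Rightarrow> real) \<Rightarrow> bool" where
  "antiperiodic q f \<longleftrightarrow> (\<forall>x. f (x + q) = - f x)"

definition is_half_decomp ::
    "real \<Rightarrow> (real \<Rightarrow> real) \<Rightarrow> (real \<Rightarrow> real) \<times> (real \<Rightarrow> real) \<Rightarrow> bool" where
  "is_half_decomp q f d \<longleftrightarrow>
     periodic_fun_simple (fst d) (q / 2) \<and> antiperiodic (q / 2) (snd d) \<and>
     (\<forall>x. f x = fst d x + snd d x)"

text \<open>The definite descriptions below are meaningful only for \<open>q\<close>-periodic \<open>f\<close>,
  where the next lemma provides existence and uniqueness.\<close>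

lemma half_decomp_ex1:
  assumes "periodic_fun_simple f q"
  shows "\<exists>!d. is_half_decomp q f d"
proof -
  have per: "f (x + q) = f x" for x
    using assms by (simp add: periodic_fun_simple_def)
  define g where "g = (\<lambda>x. (f x + f (x + q / 2)) / 2)"
  define h where "h = (\<lambda>x. (f x - f (x + q / 2)) / 2)"
  have shift: "f (x + q / 2 + q / 2) = f x" for x
    using per[of x] by (simp add: add.assoc)
  show ?thesis
  proof (rule ex1I[of _ "(g, h)"])
    show "is_half_decomp q f (g, h)"
      unfolding is_half_decomp_def antiperiodic_def periodic_fun_simple_def g_def h_def
      by (simp add: shift diff_divide_distrib add_divide_distrib per per[unfolded add.commute[of _ q]])
  next
    fix d assume d: "is_half_decomp q f d"
    have a: "fst d (x + q / 2) = fst d x" "snd d (x + q / 2) = - snd d x"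
      "f x = fst d x + snd d x" for x
      using d by (simp_all add: is_half_decomp_def antiperiodic_def periodic_fun_simple_def)
    have "fst d x = g x" "snd d x = h x" for x
      using a[of x] a(3)[of "x + q / 2"] by (simp_all add: g_def h_def)
    then show "d = (g, h)"
      by (simp add: prod_eq_iff fun_eq_iff)
  qed
qed

definition half_periodic_part :: "real \<Rightarrow> (real \<Rightarrow> real) \<Rightarrow> real \<Rightarrow> real" where
  "half_periodic_part q f = fst (THE d. is_half_decomp q f d)"

definition half_antiperiodic_part :: "real \<Rightarrow> (real \<Rightarrow> real) \<Rightarrow> real \<Rightarrow> real" where
  "half_antiperiodic_part q f = snd (THE d. is_half_decomp q f d)"

primrec periodic_gen :: "real \<Rightarrow> (real \<Rightarrow> real) \<Rightarrow> nat \<Rightarrow> real \<Rightarrow> real" where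
  "periodic_gen p f 0 = f"
| "periodic_gen p f (Suc n) = half_periodic_part (p / 2 ^ n) (periodic_gen p f n)"

text \<open>Antiperiodic generations exist only for \<open>n \<ge> 1\<close>; the value at \<open>n = 0\<close> is a dummy.\<close>

definition antiperiodic_gen :: "real \<Rightarrow> (real \<Rightarrow> real) \<Rightarrow> nat \<Rightarrow> real \<Rightarrow> real" where
  "antiperiodic_gen p f n = half_antiperiodic_part (p / 2 ^ (n - 1)) (periodic_gen p f (n - 1))"

lemma generations_decomp:
  assumes "periodic_fun_simple f p"
  shows "periodic_fun_simple (periodic_gen p f n) (p / 2 ^ n)"
    and "antiperiodic (p / 2 ^ Suc n) (antiperiodic_gen p f (Suc n))"
    and "periodic_gen p f n x = periodic_gen p f (Suc n) x + antiperiodic_gen p f (Suc n) x"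
proof -
  have step: "is_half_decomp (p / 2 ^ n) (periodic_gen p f n)
      (periodic_gen p f (Suc n), antiperiodic_gen p f (Suc n))"
    if "periodic_fun_simple (periodic_gen p f n) (p / 2 ^ n)" for n
    using theI'[OF half_decomp_ex1[OF that]]
    by (simp add: half_periodic_part_def half_antiperiodic_part_def antiperiodic_gen_def)
  have per: "periodic_fun_simple (periodic_gen p f n) (p / 2 ^ n)" for n
  proof (induction n)
    case 0
    then show ?case using assms by simp
  next
    case (Suc n)
    then show ?case using step[OF Suc] by (simp add: is_half_decomp_def mult.commute)
  qed
  show "periodic_fun_simple (periodic_gen p f n) (p / 2 ^ n)" by (rule per)
  show "antiperiodic (p / 2 ^ Suc n) (antiperiodic_gen p f (Suc n))"
    using step[OF per[of n]] by (simp add: is_half_decomp_def mult.commute)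
  show "periodic_gen p f n x = periodic_gen p f (Suc n) x + antiperiodic_gen p f (Suc n) x"
    using step[OF per[of n]] unfolding is_half_decomp_def fst_conv snd_conv by blast
qed

end

theory Submission imports Defs begin

text \<open>The decompositions telescope: since each antiperiodic generation is the difference of two
  consecutive periodic generations, the \<open>N\<close>-th partial sum of the series misses \<open>f\<close> by exactly the
  \<open>N\<close>-th periodic generation. The hypothesis says that this remainder tends to \<open>0\<close> uniformly.\<close>

lemma sum_antiperiodic_gen:
  assumes "periodic_fun_simple f p"
  shows "(\<Sum>n=1..N. antiperiodic_gen p f n x) = f x - periodic_gen p f N x"
proof (induction N)
  case (Suc N)
  then show ?case
    using generations_decomp(3)[OF assms, of N x] by simp
qed simp

lemma uniform_limit_zero_if_SUP_ereal_tendsto_zero: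
  fixes g :: "nat \<Rightarrow> 'a \<Rightarrow> real"
  assumes "(\<lambda>n. SUP x\<in>S. ereal \<bar>g n x\<bar>) \<longlonglongrightarrow> 0"
  shows "uniform_limit S g (\<lambda>x. 0) sequentially"
proof (rule uniform_limitI)
  fix e :: real
  assume "e > 0"
  then have "\<forall>\<^sub>F n in sequentially. (SUP x\<in>S. ereal \<bar>g n x\<bar>) < ereal e"
    by (intro order_tendstoD(2)[OF assms]) simp
  then show "\<forall>\<^sub>F n in sequentially. \<forall>x\<in>S. dist (g n x) 0 < e"
  proof eventually_elim
    case (elim n)
    show ?case
    proof
      fix x assume "x \<in> S"
      then have "ereal \<bar>g n x\<bar> \<le> (SUP x\<in>S. ereal \<bar>g n x\<bar>)"
        by (rule SUP_upper)
      with elim have "ereal \<bar>g n x\<bar> < ereal e"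
        by (rule le_less_trans[rotated])
      then show "dist (g n x) 0 < e"
        by simp
    qed
  qed
qed

theorem theorem2p7:
  fixes p x0 :: real and f :: "real \<Rightarrow> real"
  assumes "p > 0"
    and "periodic_fun_simple f p"
    and "(\<lambda>n. SUP x\<in>{x0..x0 + p}. ereal \<bar>periodic_gen p f n x\<bar>) \<longlonglongrightarrow> 0"
  shows "(\<forall>x\<in>{x0..x0 + p}. (\<lambda>n. antiperiodic_gen p f (Suc n) x) sums f x) \<and>
    uniform_limit {x0..x0 + p} (\<lambda>N x. \<Sum>n=1..N. antiperiodic_gen p f n x) f sequentially"
proof -
  have "uniform_limit {x0..x0 + p} (periodic_gen p f) (\<lambda>x. 0) sequentially"
    using assms(3) by (rule uniform_limit_zero_if_SUP_ereal_tendsto_zero)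
  then have unif: "uniform_limit {x0..x0 + p}
      (\<lambda>N x. \<Sum>n=1..N. antiperiodic_gen p f n x) f sequentially"
    by (simp add: uniform_limit_iff sum_antiperiodic_gen[OF assms(2), unfolded One_nat_def] dist_real_def)
  have "(\<lambda>n. antiperiodic_gen p f (Suc n) x) sums f x" if "x \<in> {x0..x0 + p}" for x
  proof -
    have "(\<Sum>n<N. antiperiodic_gen p f (Suc n) x) = (\<Sum>n=1..N. antiperiodic_gen p f n x)" for N
      by (rule sum.reindex_bij_witness[of _ "\<lambda>n. n - 1" Suc]) auto
    then show ?thesis
      unfolding sums_def using tendsto_uniform_limitI[OF unif that] by simp
  qed
  with unif show ?thesis
    by blast
qed

end
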